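(* There exist a dimension $d\ge1$, nonempty compact convex sets $\Theta_S\subsetneq\Theta_L\subseteq\mathbb{R}^d$, and a constant $\sigma_1<\infty$ such that, for every $\sigma\in(\sigma_1,\infty)$ with $\sigma>0$, $$\sup_{\theta\in\Theta_S}R_\sigma(\theta;\Theta_S)>\sup_{\theta\in\Theta_L}R_\sigma(\theta;\Theta_L).$$
   Context: For a nonempty compact convex set $\Theta\subseteq\mathbb{R}^d$, $\Pi_\Theta(y)=\arg\min_{\theta\in\Theta}\|y-\theta\|^2$ is the Euclidean projection. For $\theta\in\Theta$ and $\sigma>0$, $R_\sigma(\theta;\Theta)=\mathbb{E}\|\Pi_\Theta(\theta+\sigma Z)-\theta\|^2$ with $Z\sim N(0,I_d)$. *)

theory Defs
  imports "HOL-Probability.Probability" "HOL-Analysis.Abstract_Euclidean_Space"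
begin

text \<open>
  The dimension is existentially quantified in the statement, so \<open>d\<close>-dimensional real space is
  represented by \<^const>\<open>Euclidean_space\<close>: its points are the functions \<open>x :: nat \<Rightarrow> real\<close> with
  \<open>x i = 0\<close> for all \<open>i \<ge> d\<close>. The function type carries no vector space or norm structure, hence
  the coordinatewise versions of convexity and Euclidean distance below.
\<close>

definition euclidean_dist :: "nat \<Rightarrow> (nat \<Rightarrow> real) \<Rightarrow> (nat \<Rightarrow> real) \<Rightarrow> real" where
  "euclidean_dist d x y = L2_set (\<lambda>i. x i - y i) {..<d}"

definition convex_fun_set :: "(nat \<Rightarrow> real) set \<Rightarrow> bool" where
  "convex_fun_set S \<longleftrightarrow>
     (\<forall>x\<in>S. \<forall>y\<in>S. \<forall>u\<ge>0. \<forall>v\<ge>0. u + v = 1 \<longrightarrow> (\<lambda>i. u * x i + v * y i) \<in> S)"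

definition nonempty_compact_convex :: "nat \<Rightarrow> (nat \<Rightarrow> real) set \<Rightarrow> bool" where
  "nonempty_compact_convex d \<Theta> \<longleftrightarrow>
     \<Theta> \<noteq> {} \<and> compactin (Euclidean_space d) \<Theta> \<and> convex_fun_set \<Theta>"

definition euclidean_proj :: "nat \<Rightarrow> (nat \<Rightarrow> real) set \<Rightarrow> (nat \<Rightarrow> real) \<Rightarrow> (nat \<Rightarrow> real)" where
  "euclidean_proj d \<Theta> y = arg_min_on (\<lambda>\<theta>. (euclidean_dist d y \<theta>)\<^sup>2) \<Theta>"

text \<open>
  The law of a vector with \<open>d\<close> independent standard normal coordinates. Its sample points are
  functions on \<open>{..<d}\<close> that are \<^const>\<open>undefined\<close> elsewhere, which is why the noisy observation
  in \<open>proj_risk\<close> is set to \<open>0\<close> explicitly outside the first \<open>d\<close> coordinates.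
\<close>

definition std_gaussian :: "nat \<Rightarrow> (nat \<Rightarrow> real) measure" where
  "std_gaussian d = (\<Pi>\<^sub>M i\<in>{..<d}. density lborel std_normal_density)"

definition proj_risk :: "nat \<Rightarrow> real \<Rightarrow> (nat \<Rightarrow> real) \<Rightarrow> (nat \<Rightarrow> real) set \<Rightarrow> real" where
  "proj_risk d \<sigma> \<theta> \<Theta> =
     (\<integral>z. (euclidean_dist d
             (euclidean_proj d \<Theta> (\<lambda>i. if i < d then \<theta> i + \<sigma> * z i else 0)) \<theta>)\<^sup>2
        \<partial>std_gaussian d)"

end

theory Submission
  imports Defs
begin

text \<open>
  The example lives in the plane: the small set is the segment from \<open>(-1, 0)\<close> to \<open>(1, 0)\<close>, and the
  large set is the rhombus \<open>\<bar>x\<bar> + 2 \<bar>y\<bar> \<le> 1\<close>, the convex hull of this segment and the two points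
  \<open>(0, 1/2)\<close> and \<open>(0, -1/2)\<close>.

  As \<open>\<sigma>\<close> grows, the projection of \<open>\<theta> + \<sigma> Z\<close> onto a polytope tends almost surely to the vertex \<open>V\<close> that
  maximises the linear functional \<open>Z\<close>, whatever \<open>\<theta>\<close> is. Both sets are symmetric about the origin, so \<open>V\<close> has
  mean \<open>0\<close> and the limiting risk at \<open>\<theta>\<close> is \<open>E \<bar>V\<bar>\<^sup>2 + \<bar>\<theta>\<bar>\<^sup>2\<close>. Its supremum is \<open>E \<bar>V\<bar>\<^sup>2 + 1\<close> for both sets.
  For the segment \<open>\<bar>V\<bar> = 1\<close> and the supremum is \<open>2\<close>. For the rhombus the two short vertices
  are selected with positive probability, so \<open>E \<bar>V\<bar>\<^sup>2 < 1\<close> and the supremum is smaller than \<open>2\<close>: the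
  additional vertices pull the projection towards the origin without making the set any longer.

  To pass from the limit to all large \<open>\<sigma>\<close>, one uses that the projection equals \<open>V\<close> exactly, uniformly
  in \<open>\<theta>\<close>, unless \<open>Z\<close> lies within distance of order \<open>1 / \<sigma>\<close> of the boundary of a normal cone
  (\<open>euclidean_proj_rhombus\<close>). Such \<open>Z\<close> have probability of order \<open>1 / \<sigma>\<close>
  (\<open>measure_gauss_plane_cone_strip_le\<close>), so the errors are of that order too. This gives
  the lower bound \<open>2 - 8 / \<sigma>\<close> for the segment (\<open>proj_risk_segment_endpoint_ge\<close>) and the upper bound
  \<open>2 - 3/4 p + 80 / \<sigma>\<close> for the rhombus (\<open>proj_risk_rhombus_le\<close>), where \<open>p > 0\<close> is the Gaussian measure of
  a box inside the normal cone of a short vertex.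
\<close>

section \<open>The plane and its compact convex sets\<close>

definition plane_point :: "real \<times> real \<Rightarrow> nat \<Rightarrow> real" where
  "plane_point p = (\<lambda>i. if i = 0 then fst p else if i = 1 then snd p else 0)"

lemma plane_point_simps [simp]:
  "plane_point p 0 = fst p" "plane_point p (Suc 0) = snd p"
  by (simp_all add: plane_point_def)

lemma plane_point_zero: "2 \<le> i \<Longrightarrow> plane_point p i = 0"
  by (simp add: plane_point_def)

lemma sum_lessThan_2: "(\<Sum>i<2. f i) = f 0 + f (Suc 0)" for f :: "nat \<Rightarrow> real"
  by (simp add: numeral_2_eq_2)

lemma euclidean_dist_plane_point:
  "(euclidean_dist 2 y (plane_point p))\<^sup>2 = (y 0 - fst p)\<^sup>2 + (y 1 - snd p)\<^sup>2"
  by (simp add: euclidean_dist_def L2_set_def sum_lessThan_2 sum_nonneg)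

lemma nonempty_compact_convex_plane_point:
  assumes "K \<noteq> {}" "compact K" "convex K"
  shows "nonempty_compact_convex 2 (plane_point ` K)"
proof -
  have "continuous_on UNIV (\<lambda>p. plane_point p i)" for i
    by (cases "i = 0"; cases "i = 1") (auto simp: plane_point_def intro!: continuous_intros)
  then have "continuous_map euclidean (Euclidean_space 2) plane_point"
    unfolding Euclidean_space_def continuous_map_in_subtopology continuous_map_componentwise_UNIV
    by (simp add: plane_point_zero)
  then have "compactin (Euclidean_space 2) (plane_point ` K)"
    using assms(2) by (intro image_compactin) auto
  moreover have "convex_fun_set (plane_point ` K)"
    unfolding convex_fun_set_def
  proof (intro ballI allI impI)
    fix x y and u v :: real
    assume "x \<in> plane_point ` K" "y \<in> plane_point ` K" and uv: "0 \<le> u" "0 \<le> v" "u + v = 1"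
    then obtain p q where p: "x = plane_point p" "p \<in> K" and q: "y = plane_point q" "q \<in> K"
      by auto
    have "(\<lambda>i. u * x i + v * y i) = plane_point (u *\<^sub>R p + v *\<^sub>R q)"
      unfolding p q by (auto simp: plane_point_def)
    then show "(\<lambda>i. u * x i + v * y i) \<in> plane_point ` K"
      using convexD[OF assms(3) p(2) q(2) uv] by auto
  qed
  ultimately show ?thesis
    using assms(1) by (auto simp: nonempty_compact_convex_def)
qed

section \<open>Projections in the plane\<close>

text \<open>
  The projection is chosen by a description operator, which says nothing about its value unless a
  minimiser exists; compactness provides one.
\<close>

lemma euclidean_proj_plane_point_mem:
  assumes "K \<noteq> {}" "compact K"
  shows "euclidean_proj 2 (plane_point ` K) y \<in> plane_point ` K"
proof -
  have "continuous_on K (\<lambda>p. (y 0 - fst p)\<^sup>2 + (y 1 - snd p)\<^sup>2)"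
    by (intro continuous_intros)
  from continuous_attains_inf[OF assms(2,1) this] obtain p where p: "p \<in> K"
    and min: "\<And>q. q \<in> K \<Longrightarrow>
      (y 0 - fst p)\<^sup>2 + (y 1 - snd p)\<^sup>2 \<le> (y 0 - fst q)\<^sup>2 + (y 1 - snd q)\<^sup>2"
    by blast
  show ?thesis
    unfolding euclidean_proj_def arg_min_on_def
    by (rule arg_minI[where x = "plane_point p"])
       (use p min in \<open>auto simp: euclidean_dist_plane_point not_less\<close>)
qed

lemma euclidean_proj_plane_point_eqI:
  assumes "v \<in> K"
    and "\<And>k. k \<in> K \<Longrightarrow> k \<noteq> v \<Longrightarrow>
      (y 0 - fst v)\<^sup>2 + (y 1 - snd v)\<^sup>2 < (y 0 - fst k)\<^sup>2 + (y 1 - snd k)\<^sup>2"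
  shows "euclidean_proj 2 (plane_point ` K) y = plane_point v"
  unfolding euclidean_proj_def arg_min_on_def
proof (rule arg_minI[where x = "plane_point v"])
  show "plane_point v \<in> plane_point ` K"
    using assms(1) by auto
next
  fix y' assume "y' \<in> plane_point ` K"
  then show "\<not> (euclidean_dist 2 y y')\<^sup>2 < (euclidean_dist 2 y (plane_point v))\<^sup>2"
    using assms(2) by (fastforce simp: euclidean_dist_plane_point)
next
  fix x assume x: "x \<in> plane_point ` K"
    and m: "\<forall>z. z \<in> plane_point ` K \<longrightarrow> \<not> (euclidean_dist 2 y z)\<^sup>2 < (euclidean_dist 2 y x)\<^sup>2"
  from x obtain k where k: "x = plane_point k" "k \<in> K" by auto
  have "\<not> (euclidean_dist 2 y (plane_point v))\<^sup>2 < (euclidean_dist 2 y x)\<^sup>2"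
    using m assms(1) by blast
  then have "k = v"
    using assms(2)[OF k(2)] unfolding k(1) euclidean_dist_plane_point by blast
  then show "x = plane_point v" using k by simp
qed

text \<open>
  Expanding the square about \<open>v\<close> gives
  \<open>\<bar>y - k\<bar>\<^sup>2 - \<bar>y - v\<bar>\<^sup>2 = 2 \<langle>y - v, v - k\<rangle> + \<bar>v - k\<bar>\<^sup>2\<close>, so it suffices that \<open>y - v\<close> exposes \<open>v\<close>
  as a point of \<open>K\<close>. The projection is therefore equal to a vertex, and not just close to it,
  as soon as \<open>y\<close> lies in the translated open normal cone of that vertex.
\<close>

lemma euclidean_proj_exposed:
  assumes "v \<in> K"
    and "\<And>k. k \<in> K \<Longrightarrow> k \<noteq> v \<Longrightarrow>
      (y 0 - fst v) * (fst v - fst k) + (y 1 - snd v) * (snd v - snd k) > 0"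
  shows "euclidean_proj 2 (plane_point ` K) y = plane_point v"
proof (rule euclidean_proj_plane_point_eqI[OF assms(1)])
  fix k assume "k \<in> K" "k \<noteq> v"
  from assms(2)[OF this] have "0 < 2 * ((y 0 - fst v) * (fst v - fst k)
      + (y 1 - snd v) * (snd v - snd k)) + (fst v - fst k)\<^sup>2 + (snd v - snd k)\<^sup>2"
    by (simp add: add_pos_nonneg)
  then show "(y 0 - fst v)\<^sup>2 + (y 1 - snd v)\<^sup>2 < (y 0 - fst k)\<^sup>2 + (y 1 - snd k)\<^sup>2"
    by (simp add: power2_eq_square algebra_simps)
qed

section \<open>The standard Gaussian measure of the plane\<close>

definition gauss_line :: "real measure" where
  "gauss_line = density lborel std_normal_density"

definition gauss_plane :: "(real \<times> real) measure" where
  "gauss_plane = gauss_line \<Otimes>\<^sub>M gauss_line"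

lemma sets_gauss_line [simp, measurable_cong]: "sets gauss_line = sets borel"
  by (simp add: gauss_line_def)

lemma sets_gauss_plane [simp, measurable_cong]: "sets gauss_plane = sets borel"
  using sets_pair_measure_cong[OF sets_gauss_line sets_gauss_line]
  by (simp only: gauss_plane_def borel_prod)

lemma space_gauss_line [simp]: "space gauss_line = UNIV"
  by (simp add: gauss_line_def)

lemma space_gauss_plane [simp]: "space gauss_plane = UNIV"
  using sets_eq_imp_space_eq[OF sets_gauss_plane] by simp

lemma borel_measurable_gauss_plane_coord [measurable]:
  "fst \<in> borel_measurable gauss_plane" "snd \<in> borel_measurable gauss_plane"
  by (auto intro!: borel_measurable_continuous_onI continuous_intros
      simp: measurable_cong_sets[OF sets_gauss_plane refl])

interpretation gauss_line: prob_space gauss_line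
  unfolding gauss_line_def by (rule prob_space_normal_density) simp

interpretation gauss_plane: prob_space gauss_plane
  unfolding gauss_plane_def by (intro prob_space_pair gauss_line.prob_space_axioms)

lemma gauss_plane_eqI:
  assumes "sets M = sets borel"
    and "\<And>A B. A \<in> sets borel \<Longrightarrow> B \<in> sets borel \<Longrightarrow>
      emeasure M (A \<times> B) = emeasure gauss_line A * emeasure gauss_line B"
  shows "M = gauss_plane"
proof -
  have "sets (gauss_line \<Otimes>\<^sub>M gauss_line) = sets M"
    using assms(1) sets_gauss_plane by (simp only: gauss_plane_def)
  then have "gauss_line \<Otimes>\<^sub>M gauss_line = M"
    by (intro pair_measure_eqI gauss_line.sigma_finite_measure_axioms) (simp_all add: assms(2))
  then show ?thesis
    by (simp add: gauss_plane_def)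
qed

lemma measurable_std_gaussian_2_pair [measurable]:
  "(\<lambda>z. (z 0, z 1)) \<in> std_gaussian 2 \<rightarrow>\<^sub>M borel"
  unfolding std_gaussian_def by measurable

lemma distr_std_gaussian_2: "distr (std_gaussian 2) borel (\<lambda>z. (z 0, z 1)) = gauss_plane"
proof (rule gauss_plane_eqI)
  interpret product_sigma_finite "\<lambda>i::nat. gauss_line"
    by standard
  have std: "std_gaussian 2 = (\<Pi>\<^sub>M i\<in>{..<2}. gauss_line)"
    by (simp add: std_gaussian_def gauss_line_def)
  have I: "{..<2::nat} = {0, 1}"
    by auto
  fix A B :: "real set" assume AB: "A \<in> sets borel" "B \<in> sets borel"
  have "A \<times> B \<in> sets borel"
    using AB by (simp flip: borel_prod)
  then have "emeasure (distr (std_gaussian 2) borel (\<lambda>z. (z 0, z 1))) (A \<times> B) =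
      emeasure (std_gaussian 2) ((\<lambda>z. (z 0, z 1)) -` (A \<times> B) \<inter> space (std_gaussian 2))"
    by (rule emeasure_distr[OF measurable_std_gaussian_2_pair])
  also have "(\<lambda>z. (z 0, z 1)) -` (A \<times> B) \<inter> space (std_gaussian 2) =
      (\<Pi>\<^sub>E i\<in>{..<2}. if i = 0 then A else B)"
    unfolding std space_PiM I by (simp add: PiE_iff set_eq_iff conj_ac)
  also have "emeasure (std_gaussian 2) \<dots> = emeasure gauss_line A * emeasure gauss_line B"
    unfolding std using AB
    by (subst emeasure_PiM) (simp_all add: prod.lessThan_Suc numeral_2_eq_2)
  finally show "emeasure (distr (std_gaussian 2) borel (\<lambda>z. (z 0, z 1))) (A \<times> B) =
      emeasure gauss_line A * emeasure gauss_line B" .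
qed simp

lemma gauss_line_uminus: "distr gauss_line borel uminus = gauss_line"
proof -
  have "gauss_line = density (distr lborel borel uminus) std_normal_density"
    by (simp add: gauss_line_def lborel_distr_uminus)
  also have "\<dots> = distr (density lborel (\<lambda>x. std_normal_density (- x))) borel uminus"
    by (subst density_distr) auto
  also have "\<dots> = distr gauss_line borel uminus"
    by (simp add: gauss_line_def normal_density_def)
  finally show ?thesis by simp
qed

lemma gauss_plane_uminus: "distr gauss_plane borel uminus = gauss_plane"
proof (rule gauss_plane_eqI)
  fix A B :: "real set" assume AB: "A \<in> sets borel" "B \<in> sets borel"
  have *: "emeasure gauss_line (uminus -` C) = emeasure gauss_line C"
    if "C \<in> sets borel" for C :: "real set"
    using that emeasure_distr[of "uminus" gauss_line borel C]
    by (simp add: gauss_line_uminus)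
  have m: "uminus -` C \<in> sets borel" if "C \<in> sets borel" for C :: "real set"
    using measurable_sets[of uminus borel borel C] that by simp
  have "A \<times> B \<in> sets borel"
    using AB by (simp flip: borel_prod)
  then have "emeasure (distr gauss_plane borel uminus) (A \<times> B) =
      emeasure gauss_plane (uminus -` (A \<times> B))"
    by (subst emeasure_distr) auto
  also have "uminus -` (A \<times> B) = (uminus -` A) \<times> (uminus -` B)"
    by auto
  also have "emeasure gauss_plane \<dots> = emeasure gauss_line A * emeasure gauss_line B"
    using m AB * by (simp add: gauss_plane_def gauss_line.emeasure_pair_measure_Times)
  finally show "emeasure (distr gauss_plane borel uminus) (A \<times> B) =
      emeasure gauss_line A * emeasure gauss_line B" .
qed simp

lemma integrable_gauss_plane_uminus:
  fixes u :: "real \<times> real \<Rightarrow> real"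
  assumes "integrable gauss_plane u"
  shows "integrable gauss_plane (\<lambda>z. u (- z))"
  by (rule integrable_distr[where M' = borel]) (use assms in \<open>simp_all add: gauss_plane_uminus\<close>)

text \<open>
  Averaging over \<open>z\<close> and \<open>- z\<close> turns first moments that vanish by symmetry into terms that cancel
  pointwise, so that integrals can be bounded through pointwise inequalities.
\<close>

lemma integral_gauss_plane_symmetrize:
  fixes u :: "real \<times> real \<Rightarrow> real"
  assumes "integrable gauss_plane u"
  shows "2 * (\<integral>z. u z \<partial>gauss_plane) = (\<integral>z. u z + u (- z) \<partial>gauss_plane)"
proof -
  have "u \<in> borel_measurable borel"
    using borel_measurable_integrable[OF assms] by simp
  then have "(\<integral>z. u (- z) \<partial>gauss_plane) = (\<integral>z. u z \<partial>gauss_plane)"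
    using integral_distr[of uminus gauss_plane borel u] by (simp add: gauss_plane_uminus)
  then show ?thesis
    using assms integrable_gauss_plane_uminus[OF assms] by simp
qed

text \<open>
  The standard normal density is at most \<open>1\<close>. Together with Fubini this is enough to bound the
  Gaussian mass of a thin strip by a multiple of its width.
\<close>

lemma emeasure_gauss_line_Icc_le: "emeasure gauss_line {a..b} \<le> ennreal (b - a)" if "a \<le> b"
proof -
  have "std_normal_density x \<le> 1" for x
  proof -
    have "exp (- x\<^sup>2 / 2) \<le> 1" by simp
    also have "1 \<le> sqrt (2 * pi)" using pi_gt3 by simp
    finally show ?thesis
      unfolding std_normal_density_def by (simp add: divide_le_eq)
  qed
  then have "(\<integral>\<^sup>+x. ennreal (std_normal_density x) * indicator {a..b} x \<partial>lborel)
      \<le> (\<integral>\<^sup>+x. indicator {a..b} x \<partial>lborel)"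
    by (intro nn_integral_mono) (auto simp: indicator_def)
  then show ?thesis
    using that by (simp add: gauss_line_def emeasure_density)
qed

lemma measure_gauss_plane_fibre_le:
  assumes "A \<in> sets borel" "0 \<le> c"
    and "\<And>x. emeasure gauss_line (Pair x -` A) \<le> ennreal c"
  shows "measure gauss_plane A \<le> c"
proof -
  have "emeasure gauss_plane A = (\<integral>\<^sup>+x. emeasure gauss_line (Pair x -` A) \<partial>gauss_line)"
    unfolding gauss_plane_def
    by (rule gauss_line.emeasure_pair_measure_alt)
       (simp only: assms(1) sets_gauss_plane flip: gauss_plane_def)
  also have "\<dots> \<le> (\<integral>\<^sup>+x. ennreal c \<partial>gauss_line)"
    by (intro nn_integral_mono assms(3))
  also have "\<dots> = ennreal c"
    using gauss_line.emeasure_space_1 by simp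
  finally show ?thesis
    using assms(2) by (simp add: measure_def enn2real_leI)
qed

lemma measure_gauss_plane_vertical_strip_le:
  assumes "0 \<le> t"
  shows "measure gauss_plane ({-t..t} \<times> UNIV) \<le> 2 * t"
proof -
  have "emeasure gauss_plane ({-t..t} \<times> UNIV) = emeasure gauss_line {-t..t} * emeasure gauss_line UNIV"
    unfolding gauss_plane_def by (rule gauss_line.emeasure_pair_measure_Times) auto
  also have "\<dots> = emeasure gauss_line {-t..t}"
    using gauss_line.emeasure_space_1 by simp
  also have "\<dots> \<le> ennreal (2 * t)"
    using emeasure_gauss_line_Icc_le[of "-t" t] assms by simp
  finally show ?thesis
    using assms by (simp add: measure_def enn2real_leI)
qed

text \<open>
  This strip is a neighbourhood of the two lines that separate the normal cones of the rhombus; its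
  vertical fibres are contained in two intervals of length \<open>2 * t\<close>.
\<close>

lemma measure_gauss_plane_cone_strip_le:
  assumes "0 \<le> t"
  shows "measure gauss_plane {z. \<bar>\<bar>snd z\<bar> - 2 * \<bar>fst z\<bar>\<bar> \<le> t} \<le> 4 * t"
proof (rule measure_gauss_plane_fibre_le)
  fix x :: real
  let ?I = "{2 * \<bar>x\<bar> - t..2 * \<bar>x\<bar> + t}" and ?J = "{- 2 * \<bar>x\<bar> - t..- 2 * \<bar>x\<bar> + t}"
  have "Pair x -` {z. \<bar>\<bar>snd z\<bar> - 2 * \<bar>fst z\<bar>\<bar> \<le> t} \<subseteq> ?I \<union> ?J"
    by auto
  then have "emeasure gauss_line (Pair x -` {z. \<bar>\<bar>snd z\<bar> - 2 * \<bar>fst z\<bar>\<bar> \<le> t})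
      \<le> emeasure gauss_line (?I \<union> ?J)"
    by (intro emeasure_mono) auto
  also have "\<dots> \<le> emeasure gauss_line ?I + emeasure gauss_line ?J"
    by (intro emeasure_subadditive) auto
  also have "\<dots> \<le> ennreal (2 * t) + ennreal (2 * t)"
    using emeasure_gauss_line_Icc_le[of "2 * \<bar>x\<bar> - t" "2 * \<bar>x\<bar> + t"]
      emeasure_gauss_line_Icc_le[of "- 2 * \<bar>x\<bar> - t" "- 2 * \<bar>x\<bar> + t"] assms
    by (intro add_mono) simp_all
  also have "\<dots> = ennreal (4 * t)"
    using assms by (simp flip: ennreal_plus)
  finally show "emeasure gauss_line (Pair x -` {z. \<bar>\<bar>snd z\<bar> - 2 * \<bar>fst z\<bar>\<bar> \<le> t}) \<le> ennreal (4 * t)" .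
next
  show "{z. \<bar>\<bar>snd z\<bar> - 2 * \<bar>fst z\<bar>\<bar> \<le> t} \<in> sets borel"
    by (intro borel_closed closed_Collect_le continuous_intros)
qed (use assms in simp)

lemma emeasure_gauss_line_Icc_pos: "emeasure gauss_line {a..b} > 0" if "a < b"
proof (rule ccontr)
  assume "\<not> ?thesis"
  then have "(\<integral>\<^sup>+x. ennreal (std_normal_density x) * indicator {a..b} x \<partial>lborel) = 0"
    by (simp add: gauss_line_def emeasure_density)
  then have "AE x in lborel. ennreal (std_normal_density x) * indicator {a..b} x = 0"
    by (subst (asm) nn_integral_0_iff_AE) auto
  then have "AE x in lborel. x \<notin> {a..b}"
  proof eventually_elim
    case (elim x)
    then show ?case
      using normal_density_pos[of 1 0 x] by (auto simp: indicator_def ennreal_eq_0_iff split: if_splits)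
  qed
  then have "emeasure lborel {a..b} = 0"
    by (subst (asm) AE_iff_measurable[where N = "{a..b}"]) auto
  with that show False by simp
qed

lemma measure_gauss_plane_box_pos:
  assumes "a < b" "c < d"
  shows "measure gauss_plane ({a..b} \<times> {c..d}) > 0"
proof -
  have "emeasure gauss_plane ({a..b} \<times> {c..d}) = emeasure gauss_line {a..b} * emeasure gauss_line {c..d}"
    unfolding gauss_plane_def by (rule gauss_line.emeasure_pair_measure_Times) auto
  then have "emeasure gauss_plane ({a..b} \<times> {c..d}) \<noteq> 0"
    using emeasure_gauss_line_Icc_pos[OF assms(1)] emeasure_gauss_line_Icc_pos[OF assms(2)]
    by (auto simp: zero_less_iff_neq_zero)
  then show ?thesis
    by (simp add: gauss_plane.emeasure_eq_measure zero_less_measure_iff)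
qed

section \<open>The segment and the rhombus\<close>

definition segment :: "(real \<times> real) set" where
  "segment = {-1..1} \<times> {0}"

definition rhombus :: "(real \<times> real) set" where
  "rhombus = {p. \<bar>fst p\<bar> + 2 * \<bar>snd p\<bar> \<le> 1}"

lemma segment_properties: "segment \<noteq> {}" "compact segment" "convex segment"
  unfolding segment_def by (simp, intro compact_Times, simp_all add: convex_Times)

lemma rhombus_properties: "rhombus \<noteq> {}" "compact rhombus" "convex rhombus"
proof -
  have "closed rhombus"
    unfolding rhombus_def by (intro closed_Collect_le continuous_intros)
  moreover have "rhombus \<subseteq> {-1..1} \<times> {-1..1}"
    by (auto simp: rhombus_def)
  then have "bounded rhombus"
    by (rule bounded_subset[rotated]) (intro bounded_Times bounded_closed_interval)
  ultimately show "compact rhombus"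
    by (simp add: compact_eq_bounded_closed)
  show "convex rhombus"
  proof (rule convexI)
    fix p q and u v :: real
    assume pq: "p \<in> rhombus" "q \<in> rhombus" and uv: "0 \<le> u" "0 \<le> v" "u + v = 1"
    have "\<bar>u * fst p + v * fst q\<bar> \<le> u * \<bar>fst p\<bar> + v * \<bar>fst q\<bar>"
      "\<bar>u * snd p + v * snd q\<bar> \<le> u * \<bar>snd p\<bar> + v * \<bar>snd q\<bar>"
      using abs_triangle_ineq[of "u * fst p" "v * fst q"] abs_triangle_ineq[of "u * snd p" "v * snd q"] uv
      by (simp_all add: abs_mult)
    moreover have "u * (\<bar>fst p\<bar> + 2 * \<bar>snd p\<bar>) + v * (\<bar>fst q\<bar> + 2 * \<bar>snd q\<bar>) \<le> 1"
      using pq uv by (intro convex_bound_le) (auto simp: rhombus_def)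
    ultimately show "u *\<^sub>R p + v *\<^sub>R q \<in> rhombus"
      by (simp add: rhombus_def algebra_simps)
  qed
  have "0 \<in> rhombus"
    by (simp add: rhombus_def)
  then show "rhombus \<noteq> {}"
    by blast
qed

lemma segment_psubset_rhombus: "segment \<subset> rhombus"
proof
  show "segment \<subseteq> rhombus"
    by (auto simp: segment_def rhombus_def)
  have "(0, 1/2) \<in> rhombus" "(0, 1/2) \<notin> segment"
    by (auto simp: segment_def rhombus_def)
  then show "segment \<noteq> rhombus" by blast
qed

section \<open>Risk as a Gaussian integral over the plane\<close>

text \<open>
  The loss at the noise vector \<open>w\<close>, already multiplied by the noise level.
\<close>

definition loss :: "(real \<times> real) set \<Rightarrow> real \<times> real \<Rightarrow> real \<times> real \<Rightarrow> real" where
  "loss K q w = (euclidean_dist 2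
     (euclidean_proj 2 (plane_point ` K) (plane_point (q + w))) (plane_point q))\<^sup>2"

lemma proj_risk_plane_point:
  "proj_risk 2 \<sigma> (plane_point q) (plane_point ` K) =
     (\<integral>z. loss K q (\<sigma> *\<^sub>R (z 0, z 1)) \<partial>std_gaussian 2)"
proof -
  have "(\<lambda>i. if i < 2 then plane_point q i + \<sigma> * z i else 0) = plane_point (q + \<sigma> *\<^sub>R (z 0, z 1))" for z
    by (auto simp: plane_point_def less_2_cases_iff)
  then show ?thesis
    by (simp add: proj_risk_def loss_def)
qed

text \<open>
  Measurability matters here: a non-measurable integrand has Bochner integral \<open>0\<close>.
\<close>

lemma proj_risk_eq_integral_gauss_plane:
  assumes "(\<lambda>z. loss K q (\<sigma> *\<^sub>R z)) \<in> borel_measurable borel"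
  shows "proj_risk 2 \<sigma> (plane_point q) (plane_point ` K) = (\<integral>z. loss K q (\<sigma> *\<^sub>R z) \<partial>gauss_plane)"
  using integral_distr[OF measurable_std_gaussian_2_pair assms]
  by (simp add: proj_risk_plane_point distr_std_gaussian_2 del: One_nat_def)

text \<open>
  Either the loss is integrable and the integral is monotone, or the risk is \<open>0\<close> by convention and
  lies below the integral of the nonnegative majorant. This bounds risks for sets whose projection
  has no convenient closed form.
\<close>

lemma proj_risk_le_integral_gauss_plane:
  assumes "integrable gauss_plane u" "\<And>z. loss K q (\<sigma> *\<^sub>R z) \<le> u z"
  shows "proj_risk 2 \<sigma> (plane_point q) (plane_point ` K) \<le> (\<integral>z. u z \<partial>gauss_plane)"
proof -
  have u: "u \<in> borel_measurable borel"
    using borel_measurable_integrable[OF assms(1)] by simp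
  have "integrable (distr (std_gaussian 2) borel (\<lambda>z. (z 0, z 1))) u"
    using assms(1) by (simp only: distr_std_gaussian_2)
  then have "integrable (std_gaussian 2) (\<lambda>z. u (z 0, z 1))"
    by (rule integrable_distr[OF measurable_std_gaussian_2_pair])
  then have "proj_risk 2 \<sigma> (plane_point q) (plane_point ` K) \<le> (\<integral>z. u (z 0, z 1) \<partial>std_gaussian 2)"
    unfolding proj_risk_plane_point
  proof (rule integral_mono')
    fix z :: "nat \<Rightarrow> real"
    show "loss K q (\<sigma> *\<^sub>R (z 0, z 1)) \<le> u (z 0, z 1)"
      by (rule assms(2))
    have "0 \<le> loss K q (\<sigma> *\<^sub>R (z 0, z 1))"
      by (simp add: loss_def)
    then show "0 \<le> u (z 0, z 1)"
      using assms(2) by (rule order_trans)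
  qed
  also have "\<dots> = (\<integral>z. u z \<partial>gauss_plane)"
    using integral_distr[OF measurable_std_gaussian_2_pair u]
    by (simp add: distr_std_gaussian_2 del: One_nat_def)
  finally show ?thesis .
qed

lemma rhombus_dist_le:
  assumes "p \<in> rhombus" "q \<in> rhombus"
  shows "(fst p - fst q)\<^sup>2 + (snd p - snd q)\<^sup>2 \<le> 4"
proof -
  have "(fst p - fst q)\<^sup>2 + (snd p - snd q)\<^sup>2 \<le> (\<bar>fst p - fst q\<bar> + \<bar>snd p - snd q\<bar>)\<^sup>2"
    by (simp add: power2_sum)
  also have "\<dots> \<le> 2\<^sup>2"
    using assms by (intro power_mono) (auto simp: rhombus_def)
  finally show ?thesis by simp
qed

lemma loss_le_4:
  assumes "K \<noteq> {}" "compact K" "K \<subseteq> rhombus" "q \<in> K"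
  shows "loss K q w \<le> 4"
proof -
  obtain p where "p \<in> K" "euclidean_proj 2 (plane_point ` K) (plane_point (q + w)) = plane_point p"
    using euclidean_proj_plane_point_mem[OF assms(1,2)] by blast
  then show ?thesis
    using rhombus_dist_le[of p q] assms(3,4) by (auto simp: loss_def euclidean_dist_plane_point)
qed

section \<open>The risk of the segment at an endpoint\<close>

lemma loss_segment_endpoint:
  "loss segment (1, 0) w = (max (-1) (min 1 (1 + fst w)) - 1)\<^sup>2"
proof -
  let ?y = "plane_point ((1, 0) + w)"
  let ?c = "max (-1) (min 1 (1 + fst w))"
  have "euclidean_proj 2 (plane_point ` segment) ?y = plane_point (?c, 0)"
  proof (rule euclidean_proj_plane_point_eqI)
    show "(?c, 0) \<in> segment"
      by (simp add: segment_def)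
    fix k assume "k \<in> segment" "k \<noteq> (?c, 0)"
    then obtain a where a: "k = (a, 0)" "-1 \<le> a" "a \<le> 1"
      by (auto simp: segment_def)
    then have "a \<noteq> ?c"
      using \<open>k \<noteq> (?c, 0)\<close> by blast
    with a have "\<bar>1 + fst w - ?c\<bar> < \<bar>1 + fst w - a\<bar>"
      by (auto simp: max_def min_def split: if_splits)
    then have "(1 + fst w - ?c)\<^sup>2 < (1 + fst w - a)\<^sup>2"
      using abs_le_square_iff[of "1 + fst w - a" "1 + fst w - ?c"] by linarith
    then show "(?y 0 - fst (?c, 0))\<^sup>2 + (?y 1 - snd (?c, 0))\<^sup>2 < (?y 0 - fst k)\<^sup>2 + (?y 1 - snd k)\<^sup>2"
      by (simp add: a)
  qed
  then show ?thesis
    by (simp add: loss_def euclidean_dist_plane_point)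
qed

text \<open>
  Once \<open>\<bar>\<sigma> * fst z\<bar> > 2\<close>, one of the noise vectors \<open>\<sigma> z\<close> and \<open>- \<sigma> z\<close> leaves the endpoint \<open>(1, 0)\<close>
  fixed and the other one moves it to the opposite endpoint, with squared error \<open>4\<close>. Averaging the two
  gives \<open>2\<close>, and the exceptional strip has probability at most \<open>4 / \<sigma>\<close>.
\<close>

lemma proj_risk_segment_endpoint_ge:
  assumes "\<sigma> > 0"
  shows "2 - 8 / \<sigma> \<le> proj_risk 2 \<sigma> (plane_point (1, 0)) (plane_point ` segment)"
proof -
  let ?S = "{- (2 / \<sigma>)..2 / \<sigma>} \<times> (UNIV :: real set)"
  define u where "u z = loss segment (1, 0) (\<sigma> *\<^sub>R z)" for z
  have u: "u z = (max (-1) (min 1 (1 + \<sigma> * fst z)) - 1)\<^sup>2" for z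
    by (simp add: u_def loss_segment_endpoint)
  have meas: "u \<in> borel_measurable gauss_plane"
    unfolding u by measurable
  have le4: "u z \<le> 4" for z
    unfolding u_def
    using segment_psubset_rhombus by (intro loss_le_4 segment_properties) (auto simp: segment_def)
  have int: "integrable gauss_plane u"
    by (rule gauss_plane.integrable_const_bound[where B = 4]) (use meas le4 in \<open>auto simp: u\<close>)
  have [measurable]: "?S \<in> sets borel"
    by (intro borel_closed closed_Times) auto
  have intS: "integrable gauss_plane (\<lambda>z. indicator ?S z :: real)"
    by (rule gauss_plane.integrable_const_bound[where B = 1]) (auto simp: indicator_def)
  have "4 - 4 * measure gauss_plane ?S = (\<integral>z. 4 - 4 * indicator ?S z \<partial>gauss_plane)"
    using intS gauss_plane.prob_space by (subst Bochner_Integration.integral_diff) auto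
  also have "\<dots> \<le> (\<integral>z. u z + u (- z) \<partial>gauss_plane)"
  proof (rule integral_mono)
    show "integrable gauss_plane (\<lambda>z. u z + u (- z))"
      using int integrable_gauss_plane_uminus[OF int] by simp
    fix z
    show "4 - 4 * indicator ?S z \<le> u z + u (- z)"
    proof (cases "z \<in> ?S")
      case True
      then show ?thesis by (simp add: u)
    next
      case False
      then have "2 < \<sigma> * fst z \<or> \<sigma> * fst z < - 2"
        using assms by (cases z) (auto simp: field_simps)
      then show ?thesis
        using False by (auto simp: u max_def min_def)
    qed
  qed (use intS in auto)
  also have "\<dots> = 2 * (\<integral>z. u z \<partial>gauss_plane)"
    by (rule integral_gauss_plane_symmetrize[OF int, symmetric])
  also have "(\<integral>z. u z \<partial>gauss_plane) = proj_risk 2 \<sigma> (plane_point (1, 0)) (plane_point ` segment)"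
    unfolding u_def
    by (rule proj_risk_eq_integral_gauss_plane[symmetric]) (use meas in \<open>simp add: u_def[abs_def]\<close>)
  finally show ?thesis
    using measure_gauss_plane_vertical_strip_le[of "2 / \<sigma>"] assms by simp
qed

section \<open>The risk of the rhombus\<close>

text \<open>
  The maximiser over the rhombus of the linear functional given by \<open>w\<close>, that is, the vertex whose normal
  cone contains \<open>w\<close>. On the lines \<open>\<bar>snd w\<bar> = 2 * \<bar>fst w\<bar>\<close>, where a whole edge is maximal, and at \<open>0\<close>,
  the value is a mere convention, chosen to be odd in \<open>w\<close>.
\<close>

definition exposed_vertex :: "real \<times> real \<Rightarrow> real \<times> real" where
  "exposed_vertex w =
     (if \<bar>snd w\<bar> < 2 * \<bar>fst w\<bar> then (sgn (fst w), 0) else (0, sgn (snd w) / 2))"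

lemma exposed_vertex_scaleR: "\<sigma> > 0 \<Longrightarrow> exposed_vertex (\<sigma> *\<^sub>R w) = exposed_vertex w"
  by (simp add: exposed_vertex_def sgn_mult abs_mult)

lemma exposed_vertex_uminus: "exposed_vertex (- w) = - exposed_vertex w"
  by (simp add: exposed_vertex_def sgn_minus)

text \<open>
  The form that exposure takes for the rhombus: \<open>t\<close> is the distance of a point from the vertex in
  the axial direction, \<open>r\<close> its transversal displacement, and \<open>m\<close> bounds the slope of the edges.
\<close>

lemma cone_inequality:
  fixes A B C m r t :: real
  assumes "t > 0" "\<bar>r\<bar> \<le> m * t" "\<bar>B\<bar> \<le> C" "C * m < A"
  shows "A * t - B * r > 0"
proof -
  have "B * r \<le> \<bar>B\<bar> * \<bar>r\<bar>"
    by (simp flip: abs_mult)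
  also have "\<dots> \<le> C * (m * t)"
    using assms by (intro mult_mono) auto
  also have "\<dots> < A * t"
    using assms by (simp flip: mult.assoc)
  finally show ?thesis by simp
qed

text \<open>
  Moving the observation from \<open>w\<close> to \<open>q + w - v\<close> changes the relevant linear functionals by a
  bounded amount, because \<open>q\<close> and the vertex \<open>v\<close> range over a bounded set. Hence a vector \<open>w\<close> that is
  far enough from the boundary of its normal cone still exposes the same vertex after this shift;
  \<open>5\<close> is a sufficient margin for all four vertices.
\<close>

lemma euclidean_proj_rhombus:
  assumes q: "q \<in> rhombus" and w: "5 < \<bar>\<bar>snd w\<bar> - 2 * \<bar>fst w\<bar>\<bar>"
  shows "euclidean_proj 2 (plane_point ` rhombus) (plane_point (q + w)) = plane_point (exposed_vertex w)"
proof (rule euclidean_proj_exposed)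
  show "exposed_vertex w \<in> rhombus"
    by (auto simp: exposed_vertex_def rhombus_def sgn_if)
  fix k assume k: "k \<in> rhombus" "k \<noteq> exposed_vertex w"
  have q': "\<bar>fst q\<bar> \<le> 1" "\<bar>snd q\<bar> \<le> 1 / 2"
    using q by (auto simp: rhombus_def)
  consider "\<bar>snd w\<bar> < 2 * \<bar>fst w\<bar>" "fst w > 0" | "\<bar>snd w\<bar> < 2 * \<bar>fst w\<bar>" "fst w < 0"
    | "\<not> \<bar>snd w\<bar> < 2 * \<bar>fst w\<bar>" "snd w > 0" | "\<not> \<bar>snd w\<bar> < 2 * \<bar>fst w\<bar>" "snd w < 0"
    using w by fastforce
  then show "0 < (plane_point (q + w) 0 - fst (exposed_vertex w)) * (fst (exposed_vertex w) - fst k)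
      + (plane_point (q + w) 1 - snd (exposed_vertex w)) * (snd (exposed_vertex w) - snd k)"
  proof cases
    case 1
    then have v: "exposed_vertex w = (1, 0)"
      by (simp add: exposed_vertex_def)
    have "1 - fst k > 0"
      using k v by (cases k) (auto simp: rhombus_def abs_if split: if_splits)
    moreover have "\<bar>snd k\<bar> \<le> 1 / 2 * (1 - fst k)"
      using k by (auto simp: rhombus_def)
    ultimately have "(fst q + fst w - 1) * (1 - fst k) - (snd q + snd w) * snd k > 0"
      using q' w 1 by (intro cone_inequality[where m = "1/2" and C = "1/2 + \<bar>snd w\<bar>"]) auto
    then show ?thesis
      by (simp add: v algebra_simps)
  next
    case 2
    then have v: "exposed_vertex w = (-1, 0)"
      by (simp add: exposed_vertex_def)
    have "1 + fst k > 0"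
      using k v by (cases k) (auto simp: rhombus_def abs_if split: if_splits)
    moreover have "\<bar>snd k\<bar> \<le> 1 / 2 * (1 + fst k)"
      using k by (auto simp: rhombus_def)
    ultimately have "(- fst q - fst w - 1) * (1 + fst k) - (snd q + snd w) * snd k > 0"
      using q' w 2 by (intro cone_inequality[where m = "1/2" and C = "1/2 + \<bar>snd w\<bar>"]) auto
    then show ?thesis
      by (simp add: v algebra_simps)
  next
    case 3
    then have v: "exposed_vertex w = (0, 1/2)"
      by (simp add: exposed_vertex_def)
    have "1/2 - snd k > 0"
      using k v by (cases k) (auto simp: rhombus_def abs_if split: if_splits)
    moreover have "\<bar>fst k\<bar> \<le> 2 * (1/2 - snd k)"
      using k by (auto simp: rhombus_def)
    ultimately have "(snd q + snd w - 1/2) * (1/2 - snd k) - (fst q + fst w) * fst k > 0"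
      using q' w 3 by (intro cone_inequality[where m = 2 and C = "1 + \<bar>fst w\<bar>"]) auto
    then show ?thesis
      by (simp add: v algebra_simps)
  next
    case 4
    then have v: "exposed_vertex w = (0, -1/2)"
      by (simp add: exposed_vertex_def)
    have "1/2 + snd k > 0"
      using k v by (cases k) (auto simp: rhombus_def abs_if split: if_splits)
    moreover have "\<bar>fst k\<bar> \<le> 2 * (1/2 + snd k)"
      using k by (auto simp: rhombus_def)
    ultimately have "(- snd q - snd w - 1/2) * (1/2 + snd k) - (fst q + fst w) * fst k > 0"
      using q' w 4 by (intro cone_inequality[where m = 2 and C = "1 + \<bar>fst w\<bar>"]) auto
    then show ?thesis
      by (simp add: v algebra_simps)
  qed
qed

text \<open>
  Off a strip of probability at most \<open>20 / \<sigma>\<close>, on which the loss is at most \<open>4\<close>, the projection is the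
  exposed vertex \<open>V\<close>. Since \<open>V\<close> is odd in the noise, the cross term in \<open>\<bar>V - q\<bar>\<^sup>2\<close> cancels and leaves
  \<open>E \<bar>V\<bar>\<^sup>2 + \<bar>q\<bar>\<^sup>2\<close>. Here \<open>\<bar>q\<bar>\<^sup>2 \<le> 1\<close>, while \<open>\<bar>V\<bar>\<^sup>2\<close> drops from \<open>1\<close> to \<open>1 / 4\<close> on the normal cones
  of the two short vertices, one of which contains the box \<open>{-1..1} \<times> {3..4}\<close>.
\<close>

lemma proj_risk_rhombus_le:
  assumes "\<sigma> > 0" "q \<in> rhombus"
  shows "proj_risk 2 \<sigma> (plane_point q) (plane_point ` rhombus)
    \<le> 2 - 3 / 4 * measure gauss_plane ({-1..1} \<times> {3..4}) + 80 / \<sigma>"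
proof -
  let ?S = "{z. \<bar>\<bar>snd z\<bar> - 2 * \<bar>fst z\<bar>\<bar> \<le> 5 / \<sigma>} :: (real \<times> real) set"
  let ?B = "{-1..1} \<times> {3..4} :: (real \<times> real) set"
  define d where "d z = (fst (exposed_vertex z) - fst q)\<^sup>2 + (snd (exposed_vertex z) - snd q)\<^sup>2" for z
  \<comment> \<open>An integrable majorant of the loss: the exact value off the strip, the trivial bound on it.\<close>
  define u where "u z = d z + 4 * indicator ?S z" for z
  have v: "exposed_vertex z \<in> rhombus" for z
    by (auto simp: exposed_vertex_def rhombus_def sgn_if)
  have [measurable]: "?S \<in> sets borel"
    by (intro borel_closed closed_Collect_le continuous_intros)
  have [measurable]: "?B \<in> sets borel"
    by (intro borel_closed closed_Times) auto
  have d4: "0 \<le> d z" "d z \<le> 4" for z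
    using rhombus_dist_le[OF v assms(2)] by (auto simp: d_def)
  have intS: "integrable gauss_plane (\<lambda>z. indicator ?S z :: real)"
    by (rule gauss_plane.integrable_const_bound[where B = 1]) (auto simp: indicator_def)
  have intB: "integrable gauss_plane (\<lambda>z. indicator ?B z :: real)"
    by (rule gauss_plane.integrable_const_bound[where B = 1]) (auto simp: indicator_def)
  have [measurable]: "(\<lambda>z. fst (exposed_vertex z)) \<in> borel_measurable gauss_plane"
    "(\<lambda>z. snd (exposed_vertex z)) \<in> borel_measurable gauss_plane"
    unfolding exposed_vertex_def if_distrib[of fst] if_distrib[of snd] fst_conv snd_conv
    by measurable
  have intd: "integrable gauss_plane d"
    by (rule gauss_plane.integrable_const_bound[where B = 4]) (use d4 in \<open>auto simp: d_def[abs_def]\<close>)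
  have intu: "integrable gauss_plane u"
    unfolding u_def[abs_def] using intd intS by simp
  have sym: "u z + u (- z) \<le> 4 - 3 / 2 * indicator ?B z + 8 * indicator ?S z" for z
  proof -
    let ?v = "exposed_vertex z"
    define b :: real where "b = indicator ?B z"
    have norm_v: "(fst ?v)\<^sup>2 + (snd ?v)\<^sup>2 \<le> 1 - 3 / 4 * b"
    proof (cases "z \<in> ?B")
      case True
      then have "\<not> \<bar>snd z\<bar> < 2 * \<bar>fst z\<bar>" "snd z > 0"
        by (auto simp: mem_Times_iff)
      with True show ?thesis
        by (simp add: b_def exposed_vertex_def power2_eq_square)
    next
      case False
      then show ?thesis
        by (simp add: b_def exposed_vertex_def sgn_if power2_eq_square)
    qed
    have norm_q: "(fst q)\<^sup>2 + (snd q)\<^sup>2 \<le> 1"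
    proof -
      have square_le: "x\<^sup>2 \<le> \<bar>x\<bar>" if "\<bar>x\<bar> \<le> 1" for x :: real
        using mult_left_le[of "\<bar>x\<bar>" "\<bar>x\<bar>"] that by (simp add: power2_eq_square)
      have q: "\<bar>fst q\<bar> + 2 * \<bar>snd q\<bar> \<le> 1"
        using assms(2) by (simp add: rhombus_def)
      then have "\<bar>fst q\<bar> \<le> 1" "\<bar>snd q\<bar> \<le> 1"
        by simp_all
      from square_le[OF this(1)] square_le[OF this(2)] q show ?thesis
        by linarith
    qed
    have "d z + d (- z) = 2 * ((fst ?v)\<^sup>2 + (snd ?v)\<^sup>2) + 2 * ((fst q)\<^sup>2 + (snd q)\<^sup>2)"
      by (simp add: d_def exposed_vertex_uminus power2_eq_square algebra_simps)
    also have "\<dots> \<le> 2 * (1 - 3 / 4 * b) + 2 * 1"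
      using norm_v norm_q by (intro add_mono mult_left_mono) simp_all
    finally have "d z + d (- z) \<le> 4 - 3 / 2 * b"
      by simp
    moreover have "u z + u (- z) = d z + d (- z) + 8 * indicator ?S z"
      by (simp add: u_def indicator_def)
    ultimately show ?thesis
      by (simp add: b_def)
  qed
  have "loss rhombus q (\<sigma> *\<^sub>R z) \<le> u z" for z
  proof (cases "z \<in> ?S")
    case True
    then have "4 \<le> u z"
      using d4[of z] by (simp add: u_def)
    moreover have "loss rhombus q (\<sigma> *\<^sub>R z) \<le> 4"
      using assms(2) by (intro loss_le_4 rhombus_properties) auto
    ultimately show ?thesis by linarith
  next
    case False
    then have "5 < \<sigma> * \<bar>\<bar>snd z\<bar> - 2 * \<bar>fst z\<bar>\<bar>"
      using assms(1) by (simp add: not_le divide_less_eq mult.commute)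
    also have "\<dots> = \<bar>\<sigma> * (\<bar>snd z\<bar> - 2 * \<bar>fst z\<bar>)\<bar>"
      using assms(1) by (simp add: abs_mult)
    also have "\<sigma> * (\<bar>snd z\<bar> - 2 * \<bar>fst z\<bar>) = \<bar>snd (\<sigma> *\<^sub>R z)\<bar> - 2 * \<bar>fst (\<sigma> *\<^sub>R z)\<bar>"
      using assms(1) by (simp add: abs_mult right_diff_distrib)
    finally have "loss rhombus q (\<sigma> *\<^sub>R z) = d z"
      using assms by (simp add: loss_def euclidean_proj_rhombus euclidean_dist_plane_point
          exposed_vertex_scaleR d_def power2_commute)
    then show ?thesis
      by (simp add: u_def)
  qed
  then have "proj_risk 2 \<sigma> (plane_point q) (plane_point ` rhombus) \<le> (\<integral>z. u z \<partial>gauss_plane)"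
    by (rule proj_risk_le_integral_gauss_plane[OF intu])
  moreover have "2 * (\<integral>z. u z \<partial>gauss_plane) \<le>
      (\<integral>z. 4 - 3 / 2 * indicator ?B z + 8 * indicator ?S z \<partial>gauss_plane)"
    unfolding integral_gauss_plane_symmetrize[OF intu]
    using sym by (intro integral_mono) (auto simp: intu intS intB integrable_gauss_plane_uminus)
  moreover have "\<dots> = 4 - 3 / 2 * measure gauss_plane ?B + 8 * measure gauss_plane ?S"
    using intS intB gauss_plane.prob_space by simp
  ultimately show ?thesis
    using measure_gauss_plane_cone_strip_le[of "5 / \<sigma>"] assms(1) by simp
qed

section \<open>A smaller set with larger worst-case risk\<close>

theorem theorem1p2:
  shows "\<exists>(d :: nat) (\<Theta>\<^sub>S :: (nat \<Rightarrow> real) set) (\<Theta>\<^sub>L :: (nat \<Rightarrow> real) set) (\<sigma>\<^sub>1 :: real).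
           d \<ge> 1 \<and> nonempty_compact_convex d \<Theta>\<^sub>S \<and> nonempty_compact_convex d \<Theta>\<^sub>L \<and> \<Theta>\<^sub>S \<subset> \<Theta>\<^sub>L \<and>
           (\<forall>\<sigma>. \<sigma> > \<sigma>\<^sub>1 \<and> \<sigma> > 0 \<longrightarrow>
              (SUP \<theta>\<in>\<Theta>\<^sub>S. proj_risk d \<sigma> \<theta> \<Theta>\<^sub>S) > (SUP \<theta>\<in>\<Theta>\<^sub>L. proj_risk d \<sigma> \<theta> \<Theta>\<^sub>L))"
proof -
  \<comment> \<open>The segment loses at most \<open>8 / \<sigma>\<close> from its limit \<open>2\<close>, the rhombus gains at most \<open>80 / \<sigma>\<close>
    over its limit bound \<open>2 - 3 / 4 * p\<close>; equating \<open>88 / \<sigma>\<close> with \<open>3 / 4 * p\<close> gives the threshold.\<close>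
  let ?S = "plane_point ` segment" and ?L = "plane_point ` rhombus"
  define p where "p = measure gauss_plane ({-1..1} \<times> {3..4})"
  have p: "p > 0"
    unfolding p_def by (rule measure_gauss_plane_box_pos) auto
  have "inj plane_point"
    by (rule injI) (metis plane_point_simps prod.expand)
  then have "?S \<subset> ?L"
    using segment_psubset_rhombus by (simp add: inj_image_subset_iff psubset_eq inj_image_eq_iff)
  moreover have "(SUP \<theta>\<in>?L. proj_risk 2 \<sigma> \<theta> ?L) < (SUP \<theta>\<in>?S. proj_risk 2 \<sigma> \<theta> ?S)"
    if \<sigma>: "\<sigma> > 352 / (3 * p)" "\<sigma> > 0" for \<sigma>
  proof -
    have "(SUP \<theta>\<in>?L. proj_risk 2 \<sigma> \<theta> ?L) \<le> 2 - 3 / 4 * p + 80 / \<sigma>"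
      unfolding p_def
      using rhombus_properties(1) proj_risk_rhombus_le[OF \<sigma>(2)] by (intro cSUP_least) auto
    also have "\<dots> < 2 - 8 / \<sigma>"
      using \<sigma> p by (simp add: field_simps)
    also have "\<dots> \<le> proj_risk 2 \<sigma> (plane_point (1, 0)) ?S"
      by (rule proj_risk_segment_endpoint_ge[OF \<sigma>(2)])
    also have "\<dots> \<le> (SUP \<theta>\<in>?S. proj_risk 2 \<sigma> \<theta> ?S)"
    proof (rule cSUP_upper)
      show "plane_point (1, 0) \<in> ?S"
        by (simp add: segment_def)
      have "proj_risk 2 \<sigma> (plane_point q) ?S \<le> 4" if "q \<in> segment" for q
      proof -
        have "proj_risk 2 \<sigma> (plane_point q) ?S \<le> (\<integral>z. 4 \<partial>gauss_plane)"
          using that segment_psubset_rhombus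
          by (intro proj_risk_le_integral_gauss_plane loss_le_4 segment_properties) auto
        then show ?thesis
          using gauss_plane.prob_space by simp
      qed
      then show "bdd_above ((\<lambda>\<theta>. proj_risk 2 \<sigma> \<theta> ?S) ` ?S)"
        by (auto intro!: bdd_aboveI[where M = 4])
    qed
    finally show ?thesis .
  qed
  moreover have "nonempty_compact_convex 2 ?S" "nonempty_compact_convex 2 ?L"
    by (intro nonempty_compact_convex_plane_point segment_properties rhombus_properties)+
  ultimately show ?thesis
    by (intro exI[of _ 2] exI[of _ ?S] exI[of _ ?L] exI[of _ "352 / (3 * p)"]) auto
qed

end
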